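(* Let $n,i,j$ be integers with $0<i<j\le n/2$ such that either $i=1$ or neither $i$ nor $j$ is a unit in $\mathbb{Z}_n$. If $C_n(i,j)$ is connected (equivalently $\gcd(n,i,j)=1$) and has twins, then any automorphism of $C_n(i,j)$ is a composition of some $(s,t)\in\mathbb{Z}_n\rtimes H$, acting by $a\mapsto s+ta$, and an automorphism that permutes twins.
   Context: $C_n(i,j)$ is the simple undirected graph with vertex set $\mathbb{Z}_n$ in which $a,b$ are adjacent iff $a-b\equiv\pm i$ or $a-b\equiv\pm j\pmod n$. Distinct vertices $v,w$ are twins if $N(v)=N(w)$ or $N[v]=N[w]$ (open, resp. closed neighborhoods); a graph has twins if some two distinct vertices are twins. The relation "equal or twins" is an equivalence relation on vertices; an automorphism "permutes twins" if it maps every equivalence class of this relation to itself. $U(n)$ is the group of units of $\mathbb{Z}_n$, and $H=\{t\in U(n): t\{\pm i,\pm j\}=\{\pm i,\pm j\}\}$; multiplication in $\mathbb{Z}_n\rtimes H$ is $(s,t)(s',t')=(s+ts',tt')$. *)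

theory Defs
  imports
    "HOL-Number_Theory.Residues"
    "HOL-Algebra.Bij"
    "Graph_Theory.Pair_Digraph"
    "Graph_Theory.Digraph_Component"
begin

text \<open>
  A simple undirected graph is represented as a loop-free symmetric digraph without parallel arcs
  (locale \<^locale>\<open>pair_graph\<close>), and $\mathbb{Z}_n$ as \<^const>\<open>residue_ring\<close>, whose carrier
  consists of the integers from $0$ to $n - 1$.
\<close>

definition circulant :: "int \<Rightarrow> int \<Rightarrow> int \<Rightarrow> int pair_pre_digraph" where
  "circulant n i j =
    \<lparr> pverts = carrier (residue_ring n),
      parcs = {(a, b). a \<in> carrier (residue_ring n) \<and> b \<in> carrier (residue_ring n) \<and>
        ([a - b = i] (mod n) \<or> [a - b = - i] (mod n) \<or>
         [a - b = j] (mod n) \<or> [a - b = - j] (mod n))} \<rparr>"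

lemma pair_graph_circulant:
  assumes "0 < i" "i < j" "2 * j \<le> n"
  shows "pair_graph (circulant n i j)"
proof
  show "finite (pverts (circulant n i j))"
    by (simp add: circulant_def residue_ring_def)
  have "parcs (circulant n i j) \<subseteq> pverts (circulant n i j) \<times> pverts (circulant n i j)"
    by (auto simp: circulant_def)
  then show "finite (parcs (circulant n i j))"
    by (rule finite_subset) (simp add: circulant_def residue_ring_def)
  have neg: "[a - b = - x] (mod n) \<longleftrightarrow> [b - a = x] (mod n)" for a b x :: int
    using cong_minus_minus_iff[of "b - a" x n] by simp
  show "symmetric (circulant n i j)"
    unfolding symmetric_def by (auto simp: circulant_def sym_def neg)
next
  fix e assume e: "e \<in> parcs (circulant n i j)"
  show "fst e \<in> pverts (circulant n i j)" "snd e \<in> pverts (circulant n i j)"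
    using e by (auto simp: circulant_def)
  have "\<not> n dvd i" "\<not> n dvd j"
    using assms by (auto dest: zdvd_imp_le)
  then show "fst e \<noteq> snd e"
    using e by (auto simp: circulant_def cong_iff_dvd_diff)
qed

definition nbhd :: "'a pair_pre_digraph \<Rightarrow> 'a \<Rightarrow> 'a set" where
  "nbhd G v = {w. (v, w) \<in> parcs G}"

definition closed_nbhd :: "'a pair_pre_digraph \<Rightarrow> 'a \<Rightarrow> 'a set" where
  "closed_nbhd G v = insert v (nbhd G v)"

definition twins :: "'a pair_pre_digraph \<Rightarrow> 'a \<Rightarrow> 'a \<Rightarrow> bool" where
  "twins G v w \<longleftrightarrow> v \<in> pverts G \<and> w \<in> pverts G \<and> v \<noteq> w \<and>
    (nbhd G v = nbhd G w \<or> closed_nbhd G v = closed_nbhd G w)"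

definition has_twins :: "'a pair_pre_digraph \<Rightarrow> bool" where
  "has_twins G \<longleftrightarrow> (\<exists>v w. twins G v w)"

definition twin_rel :: "'a pair_pre_digraph \<Rightarrow> 'a rel" where
  "twin_rel G = {(v, w). v \<in> pverts G \<and> w \<in> pverts G \<and> (v = w \<or> twins G v w)}"

text \<open>
  Automorphisms are taken in \<^const>\<open>Bij\<close>, i.e. extensional outside the vertex set, so that
  equality of automorphisms is equality of HOL functions and composition is \<^const>\<open>compose\<close>.
\<close>

definition graph_aut :: "'a pair_pre_digraph \<Rightarrow> ('a \<Rightarrow> 'a) set" where
  "graph_aut G = {f \<in> Bij (pverts G).
    \<forall>u \<in> pverts G. \<forall>v \<in> pverts G. (f u, f v) \<in> parcs G \<longleftrightarrow> (u, v) \<in> parcs G}"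

definition permutes_twins :: "'a pair_pre_digraph \<Rightarrow> ('a \<Rightarrow> 'a) \<Rightarrow> bool" where
  "permutes_twins G f \<longleftrightarrow> (\<forall>X \<in> pverts G // twin_rel G. f ` X = X)"

definition conn_set :: "int \<Rightarrow> int \<Rightarrow> int \<Rightarrow> int set" where
  "conn_set n i j = {i mod n, (- i) mod n, j mod n, (- j) mod n}"

definition conn_stab :: "int \<Rightarrow> int \<Rightarrow> int \<Rightarrow> int set" where
  "conn_stab n i j = {t \<in> Units (residue_ring n).
    (\<lambda>x. t \<otimes>\<^bsub>residue_ring n\<^esub> x) ` conn_set n i j = conn_set n i j}"

text \<open>The semidirect product $\mathbb{Z}_n \rtimes H$ with $H$ = \<^const>\<open>conn_stab\<close>.\<close>

definition affine_group :: "int \<Rightarrow> int \<Rightarrow> int \<Rightarrow> (int \<times> int) monoid" where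
  "affine_group n i j =
    \<lparr> carrier = carrier (residue_ring n) \<times> conn_stab n i j,
      monoid.mult = (\<lambda>(s, t) (s', t').
        (s \<oplus>\<^bsub>residue_ring n\<^esub> t \<otimes>\<^bsub>residue_ring n\<^esub> s', t \<otimes>\<^bsub>residue_ring n\<^esub> t')),
      one = (\<zero>\<^bsub>residue_ring n\<^esub>, \<one>\<^bsub>residue_ring n\<^esub>) \<rparr>"

definition affine_act :: "int \<Rightarrow> int \<times> int \<Rightarrow> int \<Rightarrow> int" where
  "affine_act n = (\<lambda>(s, t). \<lambda>a \<in> carrier (residue_ring n).
    s \<oplus>\<^bsub>residue_ring n\<^esub> t \<otimes>\<^bsub>residue_ring n\<^esub> a)"

end

theory Submission
  imports Defs
begin

text \<open>
  Twins at $v$ and $w$ mean that the connection set $\{\pm i, \pm j\}$ (or this set together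
  with $0$) is invariant under translation by $w - v \neq 0$. A set of at most five residues
  has very few translation symmetries, and comparing translates with the set itself leaves only
  the cases $n = 2(i+j)$, $(n, j) = (6i, 3i)$ and $(n, j) \in \{(4i, 2i), (5i, 2i)\}$
  (\<open>open_twins_parameters\<close>, \<open>closed_twins_parameters\<close>). Connectedness excludes a common
  divisor of $n$, $i$, $j$ greater than $1$, so $i = 1$ whenever $n$ and $j$ are
  multiples of $i$, and the graph is one of the following.

  \<^item> A complete graph ($n = 4$ or $n = 5$): all vertices are twins of each other, so every
    automorphism permutes twins.
  \<^item> A complete bipartite graph with the even numbers against the odd ones ($n = 6$, or $n = 8$
    with $i + j = 4$): vertices of equal parity are twins, and a translation brings $f(0)$ back
    into the class of $0$.
  \<^item> With $m = n/2 = i + j \neq 4$, the graph obtained from the $m$-cycle on $\mathbb{Z}_m$ with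
    steps $\pm i$ by doubling each vertex: $m - i \equiv -i$, so adjacency depends only on the
    difference modulo $m$ (\<open>conn_diff_antipodal\<close>). As $m \neq 4$, vertices of the cycle are
    determined by their neighbors, so an automorphism $f$ acts on the cycle, by
    $v \mapsto f(0) \pm v$ (\<open>cycle_automorphism_dihedral\<close>).

  In each case there is a sign $e$ such that $v \mapsto f(0) + ev$, or the identity in the complete
  case, agrees with $f$ up to twins; multiplication by a sign lies in $H$. Undoing this affine map
  leaves an automorphism that moves each vertex within its twin class
  (\<open>factor_through_affine\<close>).
\<close>

section \<open>Adjacency as a property of differences\<close>

text \<open>
  Membership of a difference in the connection set, as an $n$-periodic predicate on all integers:
  translations need no reduction to representatives.
\<close>
definition conn_diff :: "int \<Rightarrow> int \<Rightarrow> int \<Rightarrow> int \<Rightarrow> bool" where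
  "conn_diff n i j x \<longleftrightarrow> n dvd x - i \<or> n dvd x + i \<or> n dvd x - j \<or> n dvd x + j"

lemma conn_diff_cong: "[x = y] (mod n) \<Longrightarrow> conn_diff n i j x \<longleftrightarrow> conn_diff n i j y"
proof -
  have *: "n dvd x + c \<longleftrightarrow> n dvd y + c" if "[x = y] (mod n)" for c
    using that by (simp add: cong_dvd_iff cong_add)
  show "[x = y] (mod n) \<Longrightarrow> ?thesis"
    unfolding conn_diff_def using *[of "- i"] *[of i] *[of "- j"] *[of j] by simp
qed

lemma conn_diff_uminus: "conn_diff n i j (- x) \<longleftrightarrow> conn_diff n i j x"
proof -
  have "n dvd - x - c \<longleftrightarrow> n dvd x + c" for c
    using dvd_minus_iff[of n "x + c"] by simp
  from this[of i] this[of "- i"] this[of j] this[of "- j"] show ?thesis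
    by (auto simp: conn_diff_def)
qed

lemma pverts_circulant: "pverts (circulant n i j) = {0..n - 1}"
  by (simp add: circulant_def residue_ring_def)

lemma parcs_circulant:
  "(a, b) \<in> parcs (circulant n i j) \<longleftrightarrow>
    a \<in> {0..n - 1} \<and> b \<in> {0..n - 1} \<and> conn_diff n i j (a - b)"
  by (auto simp: circulant_def residue_ring_def conn_diff_def cong_iff_dvd_diff)

section \<open>Parameters of circulant graphs with twins\<close>

text \<open>
  All sums of elements of the connection set that are compared below lie strictly between $-3n$ and
  $3n$, so this turns their divisibility by $n$ into linear equations.
\<close>
lemma dvd_bounded:
  fixes n x :: int
  assumes "n dvd x" "- 3 * n < x" "x < 3 * n"
  shows "x \<in> {- 2 * n, - n, 0, n, 2 * n}"
proof -
  obtain q where q: "x = n * q" using assms(1) by (elim dvdE)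
  have n: "0 < n" using assms(2,3) by linarith
  have "n * - 3 < n * q" "n * q < n * 3" using assms(2,3) q by linarith+
  then have "- 3 < q" "q < 3" using n by (simp_all only: mult_less_cancel_left_pos)
  then have "q = -2 \<or> q = -1 \<or> q = 0 \<or> q = 1 \<or> q = 2" by linarith
  then show ?thesis using q by auto
qed

lemma conn_diff_bounded:
  assumes "0 < i" "i < j" "2 * j \<le> n" "- 2 * n \<le> x" "x \<le> 2 * n" "conn_diff n i j x"
  shows "\<exists>d \<in> {i, - i, j, - j}. x - d \<in> {- 2 * n, - n, 0, n, 2 * n}"
proof -
  have "\<exists>d \<in> {i, - i, j, - j}. n dvd x - d"
    using assms(6) by (simp add: conn_diff_def)
  then obtain d where d: "d \<in> {i, - i, j, - j}" "n dvd x - d"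
    by blast
  have "\<bar>d\<bar> \<le> j"
    using d(1) assms(1,2) unfolding insert_iff empty_iff by (elim disjE) simp_all
  then have "- 3 * n < x - d" "x - d < 3 * n"
    using assms(1-5) by linarith+
  from dvd_bounded[OF d(2) this] d(1) show ?thesis by blast
qed

text \<open>
  The translate $i + k$ lies in $\{-i, j, -j\}$, which gives three candidates $c$ for $k$ modulo
  $n$. For each of them, the translates of $-i$, $j$ and $-j$ have to lie in the connection set as
  well. By the bounds on $i$ and $j$ this is a finite case distinction into linear equations, of
  which only the two listed families are consistent. In the first family $k = n/2$ exchanges $i$
  with $-j$; in the second the set $\{i, 3i, 5i\}$ is a coset of the subgroup generated by $2i$.
\<close>
lemma open_twins_parameters:
  assumes ij: "0 < i" "i < j" "2 * j \<le> n"
    and k: "\<not> n dvd k"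
    and per: "\<And>x. conn_diff n i j x \<longleftrightarrow> conn_diff n i j (x + k)"
  shows "n = 2 * (i + j) \<or> (j = 3 * i \<and> n = 6 * i)"
proof -
  have "conn_diff n i j (i + k)"
    using per[of i] by (simp add: conn_diff_def)
  then have "n dvd k - (- 2 * i) \<or> n dvd k - (j - i) \<or> n dvd k - (- j - i)"
    using k by (auto simp: conn_diff_def algebra_simps)
  then obtain c where c: "c = - 2 * i \<or> c = j - i \<or> c = - j - i" and kc: "[k = c] (mod n)"
    unfolding cong_iff_dvd_diff by blast
  have per': "conn_diff n i j x \<longleftrightarrow> conn_diff n i j (x + c)" for x
    using per[of x] conn_diff_cong[OF cong_add[OF cong_refl kc], of i j x] by simp
  have S: "conn_diff n i j (- i + c)" "conn_diff n i j (j + c)" "conn_diff n i j (- j + c)"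
    using per'[of "- i"] per'[of j] per'[of "- j"] by (simp_all add: conn_diff_def)
  have "\<exists>d \<in> {i, - i, j, - j}. x + c - d \<in> {- 2 * n, - n, 0, n, 2 * n}"
    if "x \<in> {- i, j, - j}" for x
  proof (rule conn_diff_bounded[OF ij])
    show "- 2 * n \<le> x + c" "x + c \<le> 2 * n"
      using that c ij by auto
    show "conn_diff n i j (x + c)"
      using that S by blast
  qed
  from this[of "- i"] this[of j] this[of "- j"] show ?thesis
    using c ij by simp (smt (verit))
qed

text \<open>
  As $0$ belongs to the set $\{0, \pm i, \pm j\}$, its translate $k$ is one of $\pm i$, $\pm j$, and
  then the same finite case distinction applies. In the two surviving families
  the set is the subgroup generated by $i$, of order four or five.
\<close>
lemma closed_twins_parameters:
  assumes ij: "0 < i" "i < j" "2 * j \<le> n"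
    and k: "\<not> n dvd k"
    and per: "\<And>x. n dvd x \<or> conn_diff n i j x \<longleftrightarrow> n dvd x + k \<or> conn_diff n i j (x + k)"
  shows "j = 2 * i \<and> (n = 4 * i \<or> n = 5 * i)"
proof -
  have "conn_diff n i j k"
    using per[of 0] k by simp
  then have "n dvd k - i \<or> n dvd k - (- i) \<or> n dvd k - j \<or> n dvd k - (- j)"
    by (simp add: conn_diff_def)
  then obtain c where c: "c = i \<or> c = - i \<or> c = j \<or> c = - j" and kc: "[k = c] (mod n)"
    unfolding cong_iff_dvd_diff by blast
  have kc': "[x + k = x + c] (mod n)" for x using kc by (simp add: cong_add_lcancel)
  have per': "n dvd x \<or> conn_diff n i j x \<longleftrightarrow> n dvd x + c \<or> conn_diff n i j (x + c)" for x
    using per[of x] conn_diff_cong[OF kc', of i j x] cong_dvd_iff[OF kc'] by blast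
  have "\<exists>d \<in> {0, i, - i, j, - j}. x + c - d \<in> {- 2 * n, - n, 0, n, 2 * n}"
    if x: "x \<in> {i, - i, j, - j}" for x
  proof -
    have b: "- 2 * n \<le> x + c" "x + c \<le> 2 * n" "- 3 * n < x + c" "x + c < 3 * n"
      using x c ij by auto
    have "n dvd x + c \<or> conn_diff n i j (x + c)"
      using per'[of x] x by (auto simp: conn_diff_def)
    then show ?thesis
      using dvd_bounded[OF _ b(3,4)] conn_diff_bounded[OF ij b(1,2)] by auto
  qed
  from this[of i] this[of "- i"] this[of j] this[of "- j"] show ?thesis
    using c ij by simp (smt (verit))
qed

text \<open>
  The vertex $u = v - x$ is a neighbor of $v$ if and only if $x$ is in the connection set, and a
  neighbor of $w$ if and only if $x + (w - v)$ is.
\<close>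
lemma nbhd_circulant_eqD:
  assumes "0 < n" "v \<in> {0..n - 1}" "w \<in> {0..n - 1}"
    and eq: "nbhd (circulant n i j) v = nbhd (circulant n i j) w"
  shows "conn_diff n i j x \<longleftrightarrow> conn_diff n i j (x + (w - v))"
proof -
  define u where "u = (v - x) mod n"
  have u: "u \<in> {0..n - 1}" using assms(1) by (simp add: u_def)
  have "[v - u = v - (v - x)] (mod n)" "[w - u = w - (v - x)] (mod n)"
    unfolding u_def by (intro cong_diff cong_refl; simp)+
  moreover have "conn_diff n i j (v - u) \<longleftrightarrow> conn_diff n i j (w - u)"
    using eq u assms(2,3) by (auto simp: nbhd_def parcs_circulant)
  ultimately show ?thesis
    using conn_diff_cong by (simp add: algebra_simps)
qed

lemma closed_nbhd_circulant_eqD: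
  assumes "0 < n" "v \<in> {0..n - 1}" "w \<in> {0..n - 1}"
    and eq: "closed_nbhd (circulant n i j) v = closed_nbhd (circulant n i j) w"
  shows "n dvd x \<or> conn_diff n i j x \<longleftrightarrow>
    n dvd x + (w - v) \<or> conn_diff n i j (x + (w - v))"
proof -
  define u where "u = (v - x) mod n"
  have u: "u \<in> {0..n - 1}" using assms(1) by (simp add: u_def)
  have 1: "[v - u = v - (v - x)] (mod n)" "[w - u = w - (v - x)] (mod n)"
    unfolding u_def by (intro cong_diff cong_refl; simp)+
  have eq_iff: "u = a \<longleftrightarrow> n dvd a - u" if "a \<in> {0..n - 1}" for a
    using u that by (metis atLeastAtMost_iff cong_iff_dvd_diff cong_less_imp_eq_int
        zle_diff1_eq cong_refl)
  have "(n dvd v - u \<or> conn_diff n i j (v - u)) \<longleftrightarrow> (n dvd w - u \<or> conn_diff n i j (w - u))"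
  proof -
    have "u \<in> closed_nbhd (circulant n i j) v \<longleftrightarrow> u \<in> closed_nbhd (circulant n i j) w"
      using eq by simp
    then show ?thesis
      using u assms(2,3) eq_iff by (simp add: closed_nbhd_def nbhd_def parcs_circulant)
  qed
  then show ?thesis
    using conn_diff_cong[OF 1(1)] conn_diff_cong[OF 1(2)] cong_dvd_iff[OF 1(1)] cong_dvd_iff[OF 1(2)]
    by (simp add: algebra_simps)
qed

lemma has_twins_circulant_parameters:
  assumes ij: "0 < i" "i < j" "2 * j \<le> n" and "has_twins (circulant n i j)"
  shows "n = 2 * (i + j) \<or> (j = 3 * i \<and> n = 6 * i) \<or> (j = 2 * i \<and> (n = 4 * i \<or> n = 5 * i))"
proof -
  obtain v w where vw: "v \<in> {0..n - 1}" "w \<in> {0..n - 1}" "v \<noteq> w"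
    and tw: "nbhd (circulant n i j) v = nbhd (circulant n i j) w \<or>
      closed_nbhd (circulant n i j) v = closed_nbhd (circulant n i j) w"
    using assms(4) by (auto simp: has_twins_def twins_def pverts_circulant)
  have n: "0 < n" using ij by linarith
  have "\<not> n dvd w - v"
    using vw n dvd_imp_le_int[of "w - v" n] by auto
  then show ?thesis
    using tw open_twins_parameters[OF ij] closed_twins_parameters[OF ij]
      nbhd_circulant_eqD[OF n vw(1,2)] closed_nbhd_circulant_eqD[OF n vw(1,2)]
    by metis
qed

text \<open>
  Adjacent vertices are congruent modulo $g$, so a path from $0$ to $1$ yields $0 \equiv 1$.
\<close>
lemma connected_circulant_common_divisor:
  assumes "1 < n" "Digraph_Component.connected (with_proj (circulant n i j))"
    and g: "g dvd n" "g dvd i" "g dvd j"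
  shows "g dvd 1"
proof -
  let ?G = "mk_symmetric (with_proj (circulant n i j))"
  have "0 \<in> pverts ?G" "1 \<in> pverts ?G"
    using assms(1) by (simp_all add: mk_symmetric_def pverts_circulant)
  have wf: "wf_digraph (with_proj ?G)"
    by unfold_locales (auto simp: mk_symmetric_def parcs_circulant pverts_circulant)
  have "0 \<rightarrow>\<^sup>*\<^bsub>with_proj ?G\<^esub> (1::int)"
    using assms(2) \<open>0 \<in> pverts ?G\<close> \<open>1 \<in> pverts ?G\<close>
    unfolding Digraph_Component.connected_def strongly_connected_def by simp
  from wf this show ?thesis
  proof (induction rule: wf_digraph.reachable_induct[consumes 2, case_names base step])
    case base
    then show ?case by simp
  next
    case (step x y)
    have "conn_diff n i j (x - y) \<or> conn_diff n i j (y - x)"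
      using step(2) by (auto simp: mk_symmetric_def parcs_circulant)
    then have *: "conn_diff n i j (y - x)"
      using conn_diff_uminus[of n i j "x - y"] by auto
    have "g dvd y - x"
    proof -
      have "g dvd c \<Longrightarrow> n dvd y - x + c \<Longrightarrow> g dvd y - x" for c
        using g(1) dvd_trans dvd_add_left_iff by blast
      from this[of i] this[of "- i"] this[of j] this[of "- j"] show ?thesis
        using * g(2,3) by (auto simp: conn_diff_def)
    qed
    then show ?case using step by (metis dvd_add diff_add_cancel)
  qed
qed

section \<open>Twin classes and factorization of automorphisms\<close>

text \<open>
  Open and closed twins cannot be chained: if $N(v) = N(w)$ and $N[w] = N[u]$ with $v \neq w \neq u$,
  then $u$ is adjacent to $w$, hence to $v$, so $v \in N[u] = N[w]$ gives $v \in N(w) = N(v)$, a loop.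
\<close>
lemma (in pair_graph) trans_twin_rel: "trans (twin_rel G)"
proof (rule transI)
  have sym: "(b, a) \<in> parcs G" if "(a, b) \<in> parcs G" for a b
    using that arcs_symmetric by simp
  have mixed: False
    if "v \<noteq> w" "w \<noteq> u" "nbhd G v = nbhd G w" "closed_nbhd G w = closed_nbhd G u" for u v w
  proof -
    have "u \<in> nbhd G w"
      using that(2,4) by (auto simp: closed_nbhd_def)
    then have "(v, u) \<in> parcs G"
      using that(3) by (auto simp: nbhd_def)
    then have "v \<in> closed_nbhd G w"
      using that(4) sym by (auto simp: closed_nbhd_def nbhd_def)
    then have "v \<in> nbhd G v"
      using that(1,3) by (auto simp: closed_nbhd_def)
    then show False
      using no_loops by (force simp: nbhd_def)
  qed
  fix u v w assume "(u, v) \<in> twin_rel G" "(v, w) \<in> twin_rel G"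
  then show "(u, w) \<in> twin_rel G"
    using mixed[of u v w] mixed[of w v u] by (auto simp: twin_rel_def twins_def)
qed

text \<open>
  It suffices that each vertex is moved to a twin or fixed: then each class is mapped into itself
  by transitivity, and an injection of a finite set into itself is onto.
\<close>
lemma (in pair_graph) permutes_twinsI:
  assumes h: "h \<in> graph_aut G" and tw: "\<And>v. v \<in> pverts G \<Longrightarrow> (v, h v) \<in> twin_rel G"
  shows "permutes_twins G h"
  unfolding permutes_twins_def
proof
  fix X assume "X \<in> pverts G // twin_rel G"
  then obtain x where X: "X = twin_rel G `` {x}"
    by (auto elim: quotientE)
  have XV: "X \<subseteq> pverts G"
    by (auto simp: X twin_rel_def)
  have "h ` X \<subseteq> X"
    using XV tw trans_twin_rel by (auto simp: X dest: transD)
  moreover have "finite X" 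
    using XV finite_verts by (auto intro: finite_subset)
  moreover have "inj_on h X"
    using h XV by (auto simp: graph_aut_def Bij_def bij_betw_def intro: inj_on_subset)
  ultimately show "h ` X = X"
    by (intro endo_inj_surj)
qed

lemma sign_in_conn_stab:
  assumes "1 < n" "e = 1 \<or> e = - 1"
  shows "e mod n \<in> conn_stab n i j"
proof -
  interpret residues n "residue_ring n"
    using assms(1) by unfold_locales
  have "coprime (e mod n) n"
    using assms by auto
  moreover from this have "0 < e mod n"
    using assms(1) pos_mod_sign[of n e] by (cases "e mod n = 0") (simp, linarith)
  ultimately have "e mod n \<in> Units (residue_ring n)"
    using assms(1) by (simp add: res_units_eq)
  moreover have "(\<lambda>x. (e mod n * x) mod n) ` conn_set n i j = conn_set n i j"
    using assms(2) by (auto simp: conn_set_def mod_mult_eq mod_simps)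
  ultimately show ?thesis
    by (simp add: conn_stab_def res_mult_eq)
qed

text \<open>
  Since $e = e^{-1}$, the inverse of the affine map $a \mapsto s + ea$ is $x \mapsto e(x - s)$.
  Hence $h(v) = e(f(v) - s)$ is forced, and it is an automorphism because $f$ is one and the
  connection set is closed under negation.
\<close>
lemma factor_through_affine:
  assumes ij: "0 < i" "i < j" "2 * j \<le> n"
    and f: "f \<in> graph_aut (circulant n i j)"
    and e: "e = 1 \<or> e = - 1" and s: "s \<in> {0..n - 1}"
    and tw: "\<And>v. v \<in> {0..n - 1} \<Longrightarrow> (v, e * (f v - s) mod n) \<in> twin_rel (circulant n i j)"
  shows "\<exists>p \<in> carrier (affine_group n i j). \<exists>h \<in> graph_aut (circulant n i j).
    permutes_twins (circulant n i j) h \<and>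
    f = compose (pverts (circulant n i j)) (affine_act n p) h"
proof -
  interpret G: pair_graph "circulant n i j"
    using ij by (rule pair_graph_circulant)
  have n: "1 < n" using ij by linarith
  interpret R: residues n "residue_ring n"
    using n by unfold_locales
  define V where "V = {0..n - 1}"
  define h where "h = (\<lambda>v \<in> V. e * (f v - s) mod n)"
  have e2: "e * (e * x) = x" for x using e by auto
  have e_conn: "conn_diff n i j (e * x) \<longleftrightarrow> conn_diff n i j x" for x
    using e conn_diff_uminus by auto
  have fV: "f v \<in> V" if "v \<in> V" for v
    using f that by (auto simp: graph_aut_def Bij_def bij_betw_def pverts_circulant V_def)
  have f_adj: "conn_diff n i j (f u - f v) \<longleftrightarrow> conn_diff n i j (u - v)" if "u \<in> V" "v \<in> V" for u v
    using f fV that by (auto simp: graph_aut_def pverts_circulant parcs_circulant V_def)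
  have f_inj: "inj_on f V" and f_ext: "f \<in> extensional V"
    using f by (auto simp: graph_aut_def Bij_def bij_betw_def pverts_circulant V_def)
  have hV: "h v \<in> V" if "v \<in> V" for v
    using that n by (auto simp: h_def V_def)
  have undo: "(s + (e mod n * h v) mod n) mod n = f v" if "v \<in> V" for v
  proof -
    have "(s + (e mod n * h v) mod n) mod n = (s + e * (e * (f v - s))) mod n"
      using that by (simp add: h_def mod_simps)
    also have "\<dots> = f v mod n" by (simp only: e2) simp
    also have "\<dots> = f v" using fV[OF that] by (simp add: V_def)
    finally show ?thesis .
  qed
  have "inj_on h V"
    using f_inj undo by (metis inj_on_def)
  moreover from this have "h ` V = V"
    using hV by (intro endo_inj_surj) (auto simp: V_def)
  ultimately have "bij_betw h V V"
    by (simp add: bij_betw_def)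
  then have "h \<in> Bij V"
    by (simp add: Bij_def h_def)
  moreover have "conn_diff n i j (h u - h v) \<longleftrightarrow> conn_diff n i j (u - v)" if "u \<in> V" "v \<in> V" for u v
  proof -
    have "[h u - h v = e * (f u - s) - e * (f v - s)] (mod n)"
      using that by (auto simp: h_def intro!: cong_diff)
    then show ?thesis
      using conn_diff_cong e_conn f_adj[OF that] by (simp add: right_diff_distrib[symmetric])
  qed
  ultimately have h: "h \<in> graph_aut (circulant n i j)"
    using hV by (auto simp: graph_aut_def pverts_circulant parcs_circulant V_def)
  have "permutes_twins (circulant n i j) h"
    using h tw by (intro G.permutes_twinsI) (auto simp: pverts_circulant h_def V_def)
  moreover have "f = compose (pverts (circulant n i j)) (affine_act n (s, e mod n)) h"
  proof
    fix v
    show "f v = compose (pverts (circulant n i j)) (affine_act n (s, e mod n)) h v"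
      using undo[of v] hV[of v] f_ext
      by (auto simp: compose_def affine_act_def pverts_circulant R.res_carrier_eq R.res_add_eq
          R.res_mult_eq extensional_def V_def)
  qed
  moreover have "(s, e mod n) \<in> carrier (affine_group n i j)"
    using s sign_in_conn_stab[OF n e] by (simp add: affine_group_def R.res_carrier_eq)
  ultimately show ?thesis using h by blast
qed

text \<open>
  If adjacency depends only on differences modulo $d$, vertices congruent modulo $d$ have equal
  neighborhoods. Here $d = 2$ for the complete bipartite graphs and $d = n/2$ for doubled cycles.
\<close>
lemma twin_rel_circulantI:
  assumes "a \<in> {0..n - 1}" "b \<in> {0..n - 1}" "[a = b] (mod d)"
    and per: "\<And>x y. [x = y] (mod d) \<Longrightarrow> conn_diff n i j x \<longleftrightarrow> conn_diff n i j y"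
  shows "(a, b) \<in> twin_rel (circulant n i j)"
proof -
  have "conn_diff n i j (a - u) \<longleftrightarrow> conn_diff n i j (b - u)" for u
    using assms(3) by (intro per cong_diff cong_refl)
  then have "nbhd (circulant n i j) a = nbhd (circulant n i j) b"
    using assms(1,2) by (auto simp: nbhd_def parcs_circulant)
  then show ?thesis
    using assms(1,2) by (auto simp: twin_rel_def twins_def pverts_circulant)
qed

section \<open>Automorphisms of a doubled cycle\<close>

text \<open>
  Adjacency, in terms of differences, in the cycle on $\mathbb{Z}_m$ with steps $\pm i$.
\<close>
definition cycle_diff :: "int \<Rightarrow> int \<Rightarrow> int \<Rightarrow> bool" where
  "cycle_diff m i x \<longleftrightarrow> m dvd x - i \<or> m dvd x + i"

lemma cycle_diff_cong: "[x = y] (mod m) \<Longrightarrow> cycle_diff m i x \<longleftrightarrow> cycle_diff m i y"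
  unfolding cycle_diff_def
  by (intro arg_cong2[where f = "(\<or>)"] cong_dvd_iff cong_add cong_diff cong_refl)

text \<open>
  If $a \not\equiv b$ have the neighbors $a \pm i$ in common, then $b \equiv a + 2i$ and
  $b \equiv a - 2i$, so $4i \equiv 0$. This happens in the $4$-cycle, whose opposite vertices
  are twins.
\<close>
lemma cycle_nbhd_inj:
  assumes "2 < m" "m \<noteq> 4" "coprime i m"
    and eq: "\<And>y. cycle_diff m i (a - y) \<longleftrightarrow> cycle_diff m i (b - y)"
  shows "[a = b] (mod m)"
proof (rule ccontr)
  assume neq: "\<not> [a = b] (mod m)"
  have "cycle_diff m i (b - (a - i))" "cycle_diff m i (b - (a + i))"
    using eq[of "a - i"] eq[of "a + i"] by (simp_all add: cycle_diff_def)
  then have "m dvd b - a + 2 * i" "m dvd b - a - 2 * i"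
    using neq by (auto simp: cycle_diff_def cong_iff_dvd_diff algebra_simps dvd_diff_commute)
  from dvd_diff[OF this] have "m dvd i * 4" by (simp add: mult.commute)
  then have "m dvd 4"
    using assms(3) by (simp add: coprime_dvd_mult_right_iff coprime_commute)
  then have "m \<le> 4" "m \<noteq> 3" by (auto dest: zdvd_imp_le)
  then show False using assms(1,2) by linarith
qed

text \<open>
  Here $F$ is an automorphism of the doubled cycle, regarded as a map on the integers that is onto
  modulo $m$. Since neighborhoods determine residues modulo $m$, it is well defined and injective
  modulo $m$. Along the walk $0, i, 2i, \dots$ each step of $F$ is $\pm i$, and injectivity forbids
  turning back because $2i \not\equiv 0$; so all steps have the sign $e$ of the first one. The walk
  reaches every residue as $i$ is coprime to $m$.
\<close>
lemma cycle_automorphism_dihedral: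
  fixes F :: "int \<Rightarrow> int"
  assumes m: "2 < m" "m \<noteq> 4" and cop: "coprime i m"
    and adj: "\<And>x y. cycle_diff m i (F x - F y) \<longleftrightarrow> cycle_diff m i (x - y)"
    and surj: "\<And>z. \<exists>x. [F x = z] (mod m)"
  obtains e where "e = 1 \<or> e = - 1" "\<And>v. [F v = F 0 + e * v] (mod m)"
proof -
  have inj: "[a = b] (mod m)" if "[F a = F b] (mod m)" for a b
  proof (rule cycle_nbhd_inj[OF m cop])
    fix y
    show "cycle_diff m i (a - y) \<longleftrightarrow> cycle_diff m i (b - y)"
      using cycle_diff_cong[OF cong_diff[OF that cong_refl]] adj by blast
  qed
  have well_def: "[F a = F b] (mod m)" if "[a = b] (mod m)" for a b
  proof (rule cycle_nbhd_inj[OF m cop])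
    fix z
    obtain y where y: "[F y = z] (mod m)" using surj by blast
    show "cycle_diff m i (F a - z) \<longleftrightarrow> cycle_diff m i (F b - z)"
      using cycle_diff_cong[OF cong_diff[OF cong_refl y]] adj
        cycle_diff_cong[OF cong_diff[OF that cong_refl]] by metis
  qed
  have step: "\<exists>e. (e = 1 \<or> e = - 1) \<and> [F (x + i) = F x + e * i] (mod m)" for x
  proof -
    have "cycle_diff m i (F (x + i) - F x)"
      using adj by (simp add: cycle_diff_def)
    then have "[F (x + i) = F x + 1 * i] (mod m) \<or> [F (x + i) = F x + - 1 * i] (mod m)"
      by (simp add: cycle_diff_def cong_iff_dvd_diff algebra_simps)
    then show ?thesis by blast
  qed
  obtain e where e: "e = 1 \<or> e = - 1" and e0: "[F i = F 0 + e * i] (mod m)"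
    using step[of 0] by auto
  have along: "[F (int k * i) = F 0 + e * (int k * i)] (mod m) \<and>
    [F (int k * i + i) = F 0 + e * (int k * i + i)] (mod m)" for k
  proof (induction k)
    case 0
    then show ?case using e0 by simp
  next
    case (Suc k)
    define y where "y = int k * i"
    have y0: "[F y = F 0 + e * y] (mod m)" and y1: "[F (y + i) = F 0 + e * (y + i)] (mod m)"
      using Suc by (simp_all add: y_def)
    obtain e' where e': "e' = 1 \<or> e' = - 1"
      and "[F (y + i + i) = F (y + i) + e' * i] (mod m)"
      using step by blast
    then have y2: "[F (y + i + i) = F 0 + e * (y + i) + e' * i] (mod m)"
      using cong_add[OF y1 cong_refl] cong_trans by blast
    \<comment> \<open>A change of sign would return to the value at \<open>y\<close>, contradicting injectivity.\<close>
    have "e' = e"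
    proof (rule ccontr)
      assume "e' \<noteq> e"
      then have "F 0 + e * (y + i) + e' * i = F 0 + e * y" using e e' by auto
      then have "[F (y + i + i) = F y] (mod m)"
        using cong_trans[OF y2] cong_sym[OF y0] by (simp only:)
      then have "[y + i + i = y] (mod m)"
        by (rule inj)
      then have "m dvd i * 2"
        by (simp add: cong_iff_dvd_diff mult_2_right)
      then have "m dvd 2"
        using cop by (simp add: coprime_dvd_mult_right_iff coprime_commute)
      then show False using m(1) by (auto dest: zdvd_imp_le)
    qed
    then have "[F (y + i + i) = F 0 + e * (y + i + i)] (mod m)"
      using y2 by (simp only: distrib_left add.assoc)
    moreover have "int (Suc k) * i = y + i"
      by (simp add: y_def distrib_right)
    ultimately show ?case using y1 by simp
  qed
  have "[F v = F 0 + e * v] (mod m)" for v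
  proof -
    obtain x where x: "[i * x = 1] (mod m)"
      using cop cong_solve_coprime_int by blast
    \<comment> \<open>Reduction modulo \<open>m\<close> only serves to obtain a nonnegative number of steps.\<close>
    define k where "k = nat ((x * v) mod m)"
    have "[int k * i = x * v * i] (mod m)"
      using m by (auto simp: k_def intro!: cong_scalar_right)
    also have "[x * v * i = 1 * v] (mod m)"
      using cong_scalar_right[OF x, of v] by (simp add: mult.commute mult.left_commute)
    finally have kv: "[int k * i = v] (mod m)" by simp
    have "[F v = F (int k * i)] (mod m)"
      using kv well_def cong_sym by blast
    also have "[F (int k * i) = F 0 + e * (int k * i)] (mod m)"
      using along by blast
    also have "[F 0 + e * (int k * i) = F 0 + e * v] (mod m)"
      using kv by (intro cong_add cong_mult cong_refl)
    finally show ?thesis .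
  qed
  then show ?thesis using e that by blast
qed

text \<open>
  A multiple of $m$ is congruent to $0$ or to $m$ modulo $2m$, so the residues $\pm i$ modulo $m$
  lift to $\pm i$ and $\pm(m - i)$ modulo $2m$.
\<close>
lemma conn_diff_antipodal: "conn_diff (2 * m) i (m - i) x \<longleftrightarrow> cycle_diff m i x"
proof -
  have *: "m dvd y \<longleftrightarrow> 2 * m dvd y \<or> 2 * m dvd y + m" for y
  proof
    assume "m dvd y"
    then obtain q where q: "y = m * q" by (elim dvdE)
    show "2 * m dvd y \<or> 2 * m dvd y + m"
    proof (cases "even q")
      case True
      then show ?thesis using q by auto
    next
      case False
      then have "even (q + 1)" by simp
      then have "2 * m dvd (q + 1) * m" by (rule mult_dvd_mono) simp
      then show ?thesis using q by (simp add: algebra_simps)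
    qed
  next
    assume "2 * m dvd y \<or> 2 * m dvd y + m"
    then show "m dvd y"
      by (metis dvd_add_left_iff dvd_refl dvd_mult_right)
  qed
  have "2 * m dvd x + i - m \<longleftrightarrow> 2 * m dvd x + i + m"
    using dvd_add_left_iff[of "2 * m" "2 * m" "x + i - m"] by (simp add: add.commute)
  then show ?thesis
    using *[of "x - i"] *[of "x + i"] by (auto simp: conn_diff_def cycle_diff_def algebra_simps)
qed

section \<open>Factorization in the presence of twins\<close>
theorem theorem15:
  fixes n i j :: int and f :: "int \<Rightarrow> int"
  assumes "0 < i" and "i < j" and "2 * j \<le> n"
    and "i = 1 \<or> (i \<notin> Units (residue_ring n) \<and> j \<notin> Units (residue_ring n))"
    and "Digraph_Component.connected (with_proj (circulant n i j))"
    and "has_twins (circulant n i j)"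
    and "f \<in> graph_aut (circulant n i j)"
  shows "\<exists>p \<in> carrier (affine_group n i j). \<exists>h \<in> graph_aut (circulant n i j).
    permutes_twins (circulant n i j) h \<and>
    f = compose (pverts (circulant n i j)) (affine_act n p) h"
proof -
  note ij = assms(1-3)
  have n: "1 < n" using ij by linarith
  define V where "V = {0..n - 1}"
  have fV: "f v \<in> V" if "v \<in> V" for v
    using assms(7) that by (auto simp: graph_aut_def Bij_def bij_betw_def pverts_circulant V_def)
  have f_surj: "\<exists>v \<in> V. f v = z" if "z \<in> V" for z
  proof -
    have "f ` V = V"
      using assms(7) by (auto simp: graph_aut_def Bij_def bij_betw_def pverts_circulant V_def)
    then show ?thesis using that by (metis imageE)
  qed
  have f_adj: "conn_diff n i j (f u - f v) \<longleftrightarrow> conn_diff n i j (u - v)" if "u \<in> V" "v \<in> V" for u v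
    using assms(7) fV that by (auto simp: graph_aut_def pverts_circulant parcs_circulant V_def)
  have zero: "0 \<in> V" using n by (simp add: V_def)
  have modV: "x mod n \<in> V" for x using n by (simp add: V_def)
  note common = connected_circulant_common_divisor[OF n assms(5)]
  note factor = factor_through_affine[OF ij assms(7)]
  have i1: "i = 1" if "i dvd j" "i dvd n"
    using common[of i] that ij(1) by simp
  \<comment> \<open>For \<open>n = 2 * (i + j) = 8\<close> the underlying cycle has length four and itself has twins,
    so this case belongs to the complete bipartite graphs.\<close>
  consider (complete) "i = 1" "j = 2" "n = 4 \<or> n = 5"
    | (bipartite) "i = 1" "j = 3" "n = 6 \<or> n = 8"
    | (cycle) "n = 2 * (i + j)" "i + j \<noteq> 4"
  proof -
    have "i = 1 \<and> j = 3" if "i + j = 4" using that ij by linarith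
    then show thesis
      using has_twins_circulant_parameters[OF ij assms(6)] i1 that by fastforce
  qed
  then show ?thesis
  proof cases
    case complete
    have "n dvd x \<or> conn_diff n i j x" for x
      using complete unfolding conn_diff_def by (elim disjE; simp; presburger)
    then have "x = y \<or> conn_diff n i j (x - y)" if "x \<in> V" "y \<in> V" for x y
      using that n dvd_imp_le_int[of "x - y" n] by (force simp: V_def)
    from this have "closed_nbhd (circulant n i j) v = V" if "v \<in> V" for v
      using that by (fastforce simp: closed_nbhd_def nbhd_def parcs_circulant V_def)
    then have "(v, w) \<in> twin_rel (circulant n i j)" if "v \<in> V" "w \<in> V" for v w
      using that by (auto simp: twin_rel_def twins_def pverts_circulant V_def)
    then show ?thesis
      using zero modV by (intro factor[of 1 0]) (simp_all add: V_def)
  next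
    case bipartite
    \<comment> \<open>The odd residues are \<open>\<plusminus>1, 3\<close> modulo 6 and \<open>\<plusminus>1, \<plusminus>3\<close> modulo 8.\<close>
    have odd: "conn_diff n i j x \<longleftrightarrow> odd x" for x
      using bipartite unfolding conn_diff_def by (elim disjE; simp; presburger)
    have even_n: "even n" using bipartite by auto
    show ?thesis
    proof (rule factor[of 1 "f 0"])
      fix v assume v: "v \<in> {0..n - 1}"
      then have "odd (f v - f 0) \<longleftrightarrow> odd v"
        using f_adj[of v 0] zero by (simp add: odd V_def)
      then have "[v = (f v - f 0) mod n] (mod 2)"
        using even_n by (auto simp: cong_iff_dvd_diff dvd_mod_iff)
      then show "(v, 1 * (f v - f 0) mod n) \<in> twin_rel (circulant n i j)"
        using v modV by (intro twin_rel_circulantI[where d = 2])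
          (auto simp: V_def odd dest: cong_dvd_iff)
    qed (use fV zero in \<open>auto simp: V_def\<close>)
  next
    case cycle
    define m where "m = i + j"
    have nm: "n = 2 * m" and j: "j = m - i" and m: "2 < m" "m \<noteq> 4"
      using cycle ij by (auto simp: m_def)
    have conn: "conn_diff n i j x \<longleftrightarrow> cycle_diff m i x" for x
      unfolding nm j by (rule conn_diff_antipodal)
    have "coprime i m"
      by (rule coprimeI) (use common nm j in auto)
    moreover define F where "F x = f (x mod n)" for x
    have "cycle_diff m i (F x - F y) \<longleftrightarrow> cycle_diff m i (x - y)" for x y
    proof -
      have "[x mod n - y mod n = x - y] (mod n)"
        by (intro cong_diff) simp_all
      then show ?thesis
        using f_adj[OF modV modV] conn_diff_cong by (metis F_def conn)
    qed
    moreover have "\<exists>x. [F x = z] (mod m)" for z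
    proof -
      obtain v where "v \<in> V" "f v = z mod n" using f_surj[OF modV] by blast
      then have "F v = z mod n" by (simp add: F_def V_def)
      then have "[F v = z] (mod n)" by simp
      then show ?thesis using nm by (metis cong_dvd_modulus dvd_triv_right)
    qed
    ultimately obtain e where e: "e = 1 \<or> e = - 1" and F: "\<And>v. [F v = F 0 + e * v] (mod m)"
      using cycle_automorphism_dihedral[OF m] by metis
    show ?thesis
    proof (rule factor[OF e])
      show "f 0 \<in> {0..n - 1}" using fV zero by (simp add: V_def)
      fix v assume v: "v \<in> {0..n - 1}"
      have "[e * (f v - f 0) mod n = e * (f v - f 0)] (mod m)"
        using nm by (metis cong_dvd_modulus dvd_triv_right cong_mod_left cong_refl)
      also have "[e * (f v - f 0) = e * (e * v)] (mod m)"
        using cong_diff[OF F[of v] cong_refl[of "f 0"]] v n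
        by (intro cong_mult cong_refl) (simp add: F_def)
      also have "e * (e * v) = v" using e by auto
      finally show "(v, e * (f v - f 0) mod n) \<in> twin_rel (circulant n i j)"
        using v modV by (intro twin_rel_circulantI[where d = m])
          (auto simp: V_def conn cong_sym cycle_diff_cong)
    qed
  qed
qed

end
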